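(* For every integer $g \geq 2$ the prime power-invertibility spectrum of the coarse group $(\mathbb Z, d_g)$ is the set of prime divisors of $g$: $$\mathfrak S_{\mathcal P}(\mathbb Z, d_g) = \{ p \in \mathcal P : p \mid g \}.$$
   Context: $\mathcal P$ is the set of all primes and $\mathbb N$ includes $0$. For an integer $g \geq 2$ let $S_g = \{\pm g^n : n \in \mathbb N\}$. The word length $\ell_g(n)$ of $n \in \mathbb Z$ is the minimal number of elements of $S_g$ (counted with multiplicity) adding up to $n$ (so $\ell_g(0)=0$), and $d_g(n,m) = \ell_g(n-m)$ is the induced metric on $\mathbb Z$ (equivalently, the path metric of the Cayley graph of $\mathbb Z$ with respect to $S_g$; the paper denotes the resulting coarse structure by $\mathcal E_{\mathrm{Cay}(S_g)}$). $(\mathbb Z,d_g)$ is regarded as a coarse group under addition. A function $f\colon (\mathbb Z, d_g) \to (\mathbb Z, d_g)$ is controlled if for every $R \geq 0$ there is $S \geq 0$ such that $d_g(x,x') \leq R$ implies $d_g(f(x),f(x')) \leq S$. Two functions $f,f'$ are close if $\sup_{x} d_g(f(x),f'(x)) < \infty$. A controlled function $f$ is a coarse equivalence if there is a controlled function $h\colon (\mathbb Z, d_g)\to (\mathbb Z, d_g)$ such that $h\circ f$ and $f\circ h$ are both close to the identity. The prime power-invertibility spectrum of a coarse group is the set of primes $p$ such that the $p$-th power map is a coarse equivalence. For $(\mathbb Z, d_g)$ this is $$\mathfrak S_{\mathcal P}(\mathbb Z, d_g) = \{p \in \mathcal P : \mu_p\colon (\mathbb Z,d_g)\to(\mathbb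 Z,d_g),\ k \mapsto pk, \text{ is a coarse equivalence}\}.$$ *)

theory Defs
  imports Complex_Main "HOL-Computational_Algebra.Primes"
begin

definition power_generators :: "int \<Rightarrow> int set" where
  "power_generators g = range (\<lambda>n::nat. g ^ n) \<union> range (\<lambda>n::nat. - (g ^ n))"

text \<open>
  Word length of an integer with respect to a symmetric generating set; words are lists, so
  letters are counted with multiplicity and the empty word represents \<open>0\<close>. The minimum
  is over a nonempty set whenever \<open>S\<close> generates the integers as a monoid; this is the case for
  \<^term>\<open>power_generators g\<close>, which contains \<open>1\<close> and \<open>-1\<close>.
\<close>

definition word_length :: "int set \<Rightarrow> int \<Rightarrow> nat" where
  "word_length S n = (LEAST k. \<exists>w. set w \<subseteq> S \<and> length w = k \<and> sum_list w = n)"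

definition power_dist :: "int \<Rightarrow> int \<Rightarrow> int \<Rightarrow> real" where
  "power_dist g n m = real (word_length (power_generators g) (n - m))"

definition controlled :: "('a \<Rightarrow> 'a \<Rightarrow> real) \<Rightarrow> ('b \<Rightarrow> 'b \<Rightarrow> real) \<Rightarrow> ('a \<Rightarrow> 'b) \<Rightarrow> bool" where
  "controlled dX dY f \<longleftrightarrow>
     (\<forall>R\<ge>0. \<exists>S\<ge>0. \<forall>x x'. dX x x' \<le> R \<longrightarrow> dY (f x) (f x') \<le> S)"

definition close :: "('b \<Rightarrow> 'b \<Rightarrow> real) \<Rightarrow> ('a \<Rightarrow> 'b) \<Rightarrow> ('a \<Rightarrow> 'b) \<Rightarrow> bool" where
  "close dY f f' \<longleftrightarrow> bdd_above (range (\<lambda>x. dY (f x) (f' x)))"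

definition coarse_equivalence ::
    "('a \<Rightarrow> 'a \<Rightarrow> real) \<Rightarrow> ('b \<Rightarrow> 'b \<Rightarrow> real) \<Rightarrow> ('a \<Rightarrow> 'b) \<Rightarrow> bool" where
  "coarse_equivalence dX dY f \<longleftrightarrow>
     controlled dX dY f \<and>
     (\<exists>h. controlled dY dX h \<and> close dX (h \<circ> f) id \<and> close dY (f \<circ> h) id)"

text \<open>
  The group is written additively, so the \<open>p\<close>-th power map is multiplication by \<open>p\<close>.
\<close>

definition prime_power_spectrum :: "(int \<Rightarrow> int \<Rightarrow> real) \<Rightarrow> nat set" where
  "prime_power_spectrum d = {p. prime p \<and> coarse_equivalence d d (\<lambda>k. int p * k)}"

end

theory Submission
  imports Defs "HOL-Number_Theory.Residues"
begin

text \<open>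
  If \<open>p\<close> divides \<open>g\<close>, then multiplication by \<open>p\<close> has the coarse inverse \<open>k \<mapsto> k div p\<close>, which is
  Lipschitz because adding a letter \<open>\<plusminus>g ^ n\<close> with \<open>n > 0\<close> changes the quotient by \<open>g div p\<close> times a
  letter. If \<open>p\<close> does not divide \<open>g\<close>, the integers \<open>k = (g ^ (m * (p - 1)) - 1) div p\<close> satisfy
  \<open>\<ell>(p * k) \<le> 2\<close>, yet their lengths are unbounded: they converge \<open>g\<close>-adically to \<open>- 1 / p\<close>, whereas
  the integers of length at most \<open>L\<close> form a \<open>g\<close>-adically compact, hence closed, set.
\<close>

lemma word_length_sum_list_le:
  assumes "set w \<subseteq> S"
  shows "word_length S (sum_list w) \<le> length w"
  unfolding word_length_def by (rule Least_le) (use assms in blast)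

lemma power_generators_one: "1 \<in> power_generators g" "- 1 \<in> power_generators g"
  unfolding power_generators_def by (auto intro: range_eqI[of _ _ 0])

text \<open>The split is by exponent: \<open>0\<close> gives the two units, while a positive
  exponent allows a factor \<open>g\<close> to be pulled out, leaving a letter.\<close>

lemma power_generators_cases:
  assumes "e \<in> power_generators g"
  obtains "e = 1" | "e = - 1" | e' where "e' \<in> power_generators g" "e = g * e'"
proof -
  from assms obtain n where n: "e = g ^ n \<or> e = - (g ^ n)"
    unfolding power_generators_def by auto
  show thesis
  proof (cases n)
    case 0
    then show thesis using n that(1,2) by auto
  next
    case (Suc m)
    have "g ^ m \<in> power_generators g" "- (g ^ m) \<in> power_generators g"
      unfolding power_generators_def by auto
    then show thesis using n Suc that(3)[of "g ^ m"] that(3)[of "- (g ^ m)"] by auto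
  qed
qed

text \<open>The letters \<open>1\<close> and \<open>- 1\<close> alone spell every integer, so the
  minimum behind \<open>word_length\<close> is attained.\<close>

lemma word_length_witness:
  obtains w where "set w \<subseteq> power_generators g" "sum_list w = n"
    "length w = word_length (power_generators g) n"
proof -
  let ?w = "replicate (nat \<bar>n\<bar>) (sgn n)"
  have "set ?w \<subseteq> power_generators g"
    using power_generators_one[of g] by (auto simp: sgn_if)
  moreover have "sum_list ?w = n"
    by (simp add: sum_list_replicate abs_mult_sgn)
  ultimately have "\<exists>k w. set w \<subseteq> power_generators g \<and> length w = k \<and> sum_list w = n"
    by (intro exI[of _ "length ?w"] exI[of _ ?w]) simp
  from LeastI_ex[OF this] show thesis
    using that by (auto simp: word_length_def)
qed

lemma word_length_add_le:
  "word_length (power_generators g) (a + b)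
     \<le> word_length (power_generators g) a + word_length (power_generators g) b"
proof -
  obtain u where u: "set u \<subseteq> power_generators g" "sum_list u = a"
    "length u = word_length (power_generators g) a" by (rule word_length_witness)
  obtain v where v: "set v \<subseteq> power_generators g" "sum_list v = b"
    "length v = word_length (power_generators g) b" by (rule word_length_witness)
  show ?thesis
    using word_length_sum_list_le[of "u @ v" "power_generators g"] u v by simp
qed

lemma word_length_uminus_le:
  "word_length (power_generators g) (- n) \<le> word_length (power_generators g) n"
proof -
  obtain w where w: "set w \<subseteq> power_generators g" "sum_list w = n"
    "length w = word_length (power_generators g) n" by (rule word_length_witness)
  have "set (map uminus w) \<subseteq> power_generators g"
    using w(1) unfolding power_generators_def by auto
  moreover have "sum_list (map uminus w) = - n"
    using uminus_sum_list_map[of "\<lambda>x. x" w] w(2) by (simp add: o_def)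
  ultimately show ?thesis
    using word_length_sum_list_le[of "map uminus w" "power_generators g"] w(3) by simp
qed

lemma word_length_0 [simp]: "word_length S 0 = 0"
  using word_length_sum_list_le[of "[]" S] by simp

lemma word_length_generator_le:
  assumes "e \<in> S"
  shows "word_length S e \<le> 1"
  using word_length_sum_list_le[of "[e]" S] assms by simp

lemma word_length_nat_mult_le:
  "word_length (power_generators g) (int k * x) \<le> k * word_length (power_generators g) x"
proof (induction k)
  case (Suc k)
  then show ?case
    using word_length_add_le[of g x "int k * x"] by (simp add: distrib_right)
qed simp

text \<open>A letter \<open>1\<close> or \<open>- 1\<close> moves the quotient by at most one,
  whatever \<open>x\<close> is. In the remaining case the letter is a multiple of \<open>p\<close>,
  so no rounding occurs and the quotient shifts by \<open>q\<close> copies of a letter.\<close>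

lemma word_length_div_add_generator_le:
  assumes e: "e \<in> power_generators (int p * int q)" and pq: "p > 0" "q > 0"
  shows "word_length (power_generators (int p * int q)) ((x + e) div int p - x div int p) \<le> q"
  using e
proof (cases rule: power_generators_cases)
  case 1
  \<comment> \<open>Monotonicity squeezes the new quotient between the old one and its
    successor.\<close>
  have "x div int p \<le> (x + 1) div int p" "(x + 1) div int p \<le> (x + int p) div int p"
    by (rule zdiv_mono1; use pq in simp)+
  then have "(x + 1) div int p - x div int p \<in> {0, 1}"
    using pq by auto
  then show ?thesis
    using 1 pq word_length_generator_le[OF power_generators_one(1), of "int p * int q"] by auto
next
  case 2
  have "(x - int p) div int p = x div int p - 1"
    using pq div_mult_self1[of "int p" x "- 1"] by simp
  moreover have "(x - 1) div int p \<le> x div int p" "(x - int p) div int p \<le> (x - 1) div int p"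
    by (rule zdiv_mono1; use pq in simp)+
  ultimately have "(x - 1) div int p - x div int p \<in> {0, - 1}"
    by auto
  then show ?thesis
    using 2 pq word_length_generator_le[OF power_generators_one(2), of "int p * int q"] by auto
next
  case (3 e')
  have "(x + e) div int p - x div int p = int q * e'"
    using 3 pq div_mult_self2[of "int p" x "int q * e'"] by (simp add: mult.assoc)
  moreover have "q * word_length (power_generators (int p * int q)) e' \<le> q * 1"
    using word_length_generator_le[OF 3(1)] by (rule mult_le_mono2)
  ultimately show ?thesis
    using word_length_nat_mult_le[of "int p * int q" q e'] by (metis le_trans mult.right_neutral)
qed

text \<open>Letters are added one at a time and the increments telescope. The base point moves with
  each letter, so the induction needs arbitrary \<open>x\<close>.\<close>

lemma word_length_div_add_word_le:
  assumes "set w \<subseteq> power_generators (int p * int q)" and pq: "p > 0" "q > 0"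
  shows "word_length (power_generators (int p * int q)) ((x + sum_list w) div int p - x div int p)
           \<le> q * length w"
  using assms(1)
proof (induction w arbitrary: x)
  case (Cons e w)
  let ?l = "word_length (power_generators (int p * int q))"
  have "(x + sum_list (e # w)) div int p - x div int p =
      ((x + e + sum_list w) div int p - (x + e) div int p) + ((x + e) div int p - x div int p)"
    by (simp add: add.assoc)
  moreover have "?l ((x + e + sum_list w) div int p - (x + e) div int p) \<le> q * length w"
    using Cons by auto
  moreover have "?l ((x + e) div int p - x div int p) \<le> q"
    using Cons.prems pq by (intro word_length_div_add_generator_le) auto
  ultimately show ?case
    using word_length_add_le[of "int p * int q"
        "(x + e + sum_list w) div int p - (x + e) div int p" "(x + e) div int p - x div int p"]
    by simp
qed simp

lemma controlledI_Lipschitz: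
  assumes "C \<ge> 0" "\<And>x y. dY (f x) (f y) \<le> C * dX x y"
  shows "controlled dX dY f"
  unfolding controlled_def
proof (intro allI impI)
  fix R :: real
  assume R: "R \<ge> 0"
  have "dY (f x) (f y) \<le> C * R" if "dX x y \<le> R" for x y
    using assms(2)[of x y] mult_left_mono[OF that assms(1)] by linarith
  then show "\<exists>S\<ge>0. \<forall>x y. dX x y \<le> R \<longrightarrow> dY (f x) (f y) \<le> S"
    using assms(1) R by (intro exI[of _ "C * R"]) auto
qed

lemma controlled_mult_nat: "controlled (power_dist g) (power_dist g) (\<lambda>k. int p * k)"
proof (rule controlledI_Lipschitz)
  show "power_dist g (int p * x) (int p * y) \<le> real p * power_dist g x y" for x y
    using word_length_nat_mult_le[of g p "x - y"] 
    by (simp add: power_dist_def flip: right_diff_distrib of_nat_mult)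
qed simp

lemma controlled_div:
  assumes "p > 0" "q > 0"
  shows "controlled (power_dist (int p * int q)) (power_dist (int p * int q)) (\<lambda>k. k div int p)"
proof (rule controlledI_Lipschitz)
  let ?g = "int p * int q"
  show "power_dist ?g (x div int p) (y div int p) \<le> real q * power_dist ?g x y" for x y
  proof -
    obtain w where "set w \<subseteq> power_generators ?g" "sum_list w = x - y"
      "length w = word_length (power_generators ?g) (x - y)" by (rule word_length_witness)
    then show ?thesis
      using word_length_div_add_word_le[of w p q y] assms
      by (simp add: power_dist_def flip: of_nat_mult)
  qed
qed simp

text \<open>Division undoes multiplication exactly; in the other order the error is a remainder
  below \<open>p\<close>, hence bounded.\<close>

lemma coarse_equivalence_mult_dvd:
  assumes "p > 0" "q > 0"
  shows "coarse_equivalence (power_dist (int p * int q)) (power_dist (int p * int q))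
           (\<lambda>k. int p * k)"
  unfolding coarse_equivalence_def
proof (intro conjI exI)
  let ?g = "int p * int q"
  show "controlled (power_dist ?g) (power_dist ?g) (\<lambda>k. int p * k)"
    by (rule controlled_mult_nat)
  show "controlled (power_dist ?g) (power_dist ?g) (\<lambda>k. k div int p)"
    by (rule controlled_div) fact+
  show "close (power_dist ?g) ((\<lambda>k. k div int p) \<circ> (\<lambda>k. int p * k)) id"
    using assms by (auto simp: close_def power_dist_def)
  have "power_dist ?g (int p * (k div int p)) k \<le> real p" for k
  proof -
    have r: "k mod int p \<ge> 0" "k mod int p < int p"
      using assms by auto
    \<comment> \<open>The error is minus the remainder, read as that many letters
      \<open>- 1\<close>.\<close>
    have "int p * (k div int p) - k = int (nat (k mod int p)) * (- 1)"
      using r by (simp add: minus_mod_eq_mult_div[symmetric])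
    moreover have "word_length (power_generators ?g) (int (nat (k mod int p)) * (- 1))
        \<le> nat (k mod int p) * 1"
      by (rule order_trans[OF word_length_nat_mult_le mult_le_mono2])
         (rule word_length_generator_le[OF power_generators_one(2)])
    moreover have "nat (k mod int p) \<le> p"
      using r by simp
    ultimately show ?thesis
      unfolding power_dist_def by simp
  qed
  then show "close (power_dist ?g) ((\<lambda>k. int p * k) \<circ> (\<lambda>k. k div int p)) id"
    by (auto simp: close_def intro!: bdd_aboveI2)
qed

text \<open>
  A finitary form of the statement that integers of bounded length stay \<open>g\<close>-adically away from the
  non-integer \<open>- a / p\<close>. A letter of large exponent can be dropped modulo a power of \<open>g\<close>, while the
  finitely many letters of small exponent are absorbed into \<open>a\<close>.
\<close>

lemma bounded_words_avoid_fraction: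
  fixes g p a :: int
  assumes "g \<ge> 2" "\<not> p dvd a"
  shows "\<exists>M. \<forall>w. set w \<subseteq> power_generators g \<and> length w \<le> L
           \<longrightarrow> \<not> g ^ M dvd p * sum_list w + a"
  using assms(2)
proof (induction L arbitrary: a)
  case 0
  \<comment> \<open>For the empty word it suffices that the power exceeds the absolute value of
    \<open>a\<close>, which is nonzero because \<open>p\<close> does not divide it.\<close>
  have "\<bar>a\<bar> < g ^ nat \<bar>a\<bar>"
  proof -
    have "\<bar>a\<bar> < 2 ^ nat \<bar>a\<bar>"
      using of_nat_less_two_power[of "nat \<bar>a\<bar>", where 'a = int] by simp
    also have "\<dots> \<le> g ^ nat \<bar>a\<bar>"
      using assms(1) by (intro power_mono) auto
    finally show ?thesis .
  qed
  moreover have "a \<noteq> 0"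
    using 0 by auto
  ultimately have "\<not> g ^ nat \<bar>a\<bar> dvd a"
    using dvd_imp_le_int[of a "g ^ nat \<bar>a\<bar>"] by auto
  then show ?case
    by (intro exI[of _ "nat \<bar>a\<bar>"]) auto
next
  case (Suc L)
  let ?avoids = "\<lambda>b M. \<forall>w. set w \<subseteq> power_generators g \<and> length w \<le> L
                   \<longrightarrow> \<not> g ^ M dvd p * sum_list w + b"
  obtain N where N: "?avoids a N"
    using Suc by blast
  \<comment> \<open>These are the letters that may survive modulo \<open>g ^ N\<close>: finitely
    many, so one exponent can serve them all.\<close>
  define F where "F = (\<lambda>n. g ^ n) ` {..<N} \<union> (\<lambda>n. - (g ^ n)) ` {..<N}"
  have "finite F"
    unfolding F_def by simp
  \<comment> \<open>Shifting by a multiple of \<open>p\<close> keeps the constant indivisible by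
    \<open>p\<close>, so the induction hypothesis covers every possible first letter.\<close>
  have "\<exists>M. ?avoids (a + p * e) M" for e
    using Suc.prems by (intro Suc.IH) (simp add: dvd_add_left_iff)
  then obtain m where m: "\<And>e. ?avoids (a + p * e) (m e)"
    by metis
  define M where "M = Max (insert N (m ` F))"
  have M: "M \<ge> m e" if "e \<in> F" for e
    using \<open>finite F\<close> that unfolding M_def by auto
  have "M \<ge> N"
    using \<open>finite F\<close> unfolding M_def by auto
  have "\<not> g ^ M dvd p * sum_list w + a"
    if w: "set w \<subseteq> power_generators g" "length w \<le> Suc L" for w
  proof
    assume dvd: "g ^ M dvd p * sum_list w + a"
    have dvd_N: "g ^ N dvd p * sum_list w + a"
      using dvd \<open>M \<ge> N\<close> by (meson dvd_trans le_imp_power_dvd)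
    show False
    proof (cases w)
      case Nil
      then show False using dvd_N N[rule_format, of "[]"] by simp
    next
      case (Cons e v)
      then have v: "set v \<subseteq> power_generators g" "length v \<le> L" and e: "e \<in> power_generators g"
        using w by auto
      have sum: "p * sum_list w + a = p * sum_list v + (a + p * e)"
        using Cons by (simp add: algebra_simps)
      show False
      proof (cases "e \<in> F")
        case True
        then have "g ^ m e dvd p * sum_list v + (a + p * e)"
          using dvd M sum by (metis dvd_trans le_imp_power_dvd)
        then show False using m v by blast
      next
        case False
        obtain n where n: "e = g ^ n \<or> e = - (g ^ n)"
          using e unfolding power_generators_def by auto
        then have "N \<le> n"
          using False unfolding F_def by (metis UnCI imageI lessThan_iff not_le)
        \<comment> \<open>The first letter vanishes modulo \<open>g ^ N\<close>, so the remaining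
          word, of length at most \<open>L\<close>, contradicts the choice of
          \<open>N\<close>.\<close>
        then have "g ^ N dvd e"
          using n by (auto intro: le_imp_power_dvd)
        then have "g ^ N dvd p * sum_list w + a - p * e"
          using dvd_N by (intro dvd_diff) auto
        then show False using N v sum by (simp add: add.commute add.left_commute)
      qed
    qed
  qed
  then show ?case by blast
qed

lemma word_length_power_minus_one_le: "word_length (power_generators g) (g ^ n - 1) \<le> 2"
proof -
  have "g ^ n \<in> power_generators g"
    unfolding power_generators_def by auto
  then show ?thesis
    using word_length_sum_list_le[of "[g ^ n, - 1]" "power_generators g"] power_generators_one(2)
    by simp
qed

text \<open>The coarse inverse \<open>h\<close> brings \<open>p * k\<close> back within a fixed
  distance of \<open>k\<close>, and control keeps \<open>h (p * k)\<close> near \<open>h 0\<close>.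
  The triangle inequality through these points bounds the length of \<open>k\<close>.\<close>

lemma coarse_equivalence_mult_reflects_bounded:
  assumes "coarse_equivalence (power_dist g) (power_dist g) (\<lambda>k. p * k)"
  shows "\<exists>L. \<forall>k. word_length (power_generators g) (p * k) \<le> R
           \<longrightarrow> word_length (power_generators g) k \<le> L"
proof -
  let ?l = "word_length (power_generators g)"
  from assms obtain h where h: "controlled (power_dist g) (power_dist g) h"
    and cl: "close (power_dist g) (h \<circ> (\<lambda>k. p * k)) id"
    unfolding coarse_equivalence_def by auto
  obtain S where S: "\<And>x y. power_dist g x y \<le> real R \<Longrightarrow> power_dist g (h x) (h y) \<le> S"
    using h unfolding controlled_def by (meson of_nat_0_le_iff)
  obtain C where C: "\<And>k. power_dist g (h (p * k)) k \<le> C"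
    using cl unfolding close_def bdd_above_def by auto
  have "?l k \<le> nat \<lfloor>S + C + ?l (h 0)\<rfloor>" if k: "?l (p * k) \<le> R" for k
  proof -
    have "?l (- (h (p * k) - k)) \<le> ?l (h (p * k) - k)"
      by (rule word_length_uminus_le)
    then have "real (?l (k - h (p * k))) \<le> C"
      using C[of k] by (simp add: power_dist_def)
    moreover have "real (?l (h (p * k) - h 0)) \<le> S"
      using S[of "p * k" 0] k by (simp add: power_dist_def)
    moreover have "?l k \<le> ?l (k - h (p * k)) + (?l (h (p * k) - h 0) + ?l (h 0))"
      using word_length_add_le[of g "k - h (p * k)" "h (p * k)"]
        word_length_add_le[of g "h (p * k) - h 0" "h 0"] by simp
    ultimately show ?thesis
      by (intro le_nat_floor) linarith
  qed
  then show ?thesis by blast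
qed

theorem theorem3p9:
  fixes g :: int
  assumes "g \<ge> 2"
  shows "prime_power_spectrum (power_dist g) = {p::nat. prime p \<and> int p dvd g}"
proof -
  have "int p dvd g"
    if p: "prime p" and ce: "coarse_equivalence (power_dist g) (power_dist g) (\<lambda>k. int p * k)" for p
  proof (rule ccontr)
    assume ndvd: "\<not> int p dvd g"
    obtain L where L: "\<And>k. word_length (power_generators g) (int p * k) \<le> 2 \<Longrightarrow>
        word_length (power_generators g) k \<le> L"
      using coarse_equivalence_mult_reflects_bounded[OF ce] by blast
    have "\<not> int p dvd 1"
      using p by auto
    \<comment> \<open>The exponent \<open>M\<close> is fixed before \<open>k\<close>, which can
      therefore be built from it.\<close>
    then obtain M where M: "\<And>w. set w \<subseteq> power_generators g \<Longrightarrow> length w \<le> L \<Longrightarrow>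
        \<not> g ^ M dvd int p * sum_list w + 1"
      using bounded_words_avoid_fraction[OF assms] by blast
    have "[g ^ (p - 1) = 1] (mod int p)"
    proof -
      obtain b where b: "g = int b"
        using assms by (metis nonneg_int_cases order_trans zero_le_numeral)
      show ?thesis
        using fermat_theorem[OF p, of b] ndvd by (simp add: b flip: cong_int_iff)
    qed
    then have "[(g ^ (p - 1)) ^ M = 1 ^ M] (mod int p)"
      by (rule cong_pow)
    then have "int p dvd g ^ ((p - 1) * M) - 1"
      by (simp add: cong_iff_dvd_diff power_mult)
    \<comment> \<open>Here \<open>p * k\<close> has length at most \<open>2\<close>, whereas
      \<open>p * k + 1\<close> is a power of \<open>g\<close> with exponent at least
      \<open>M\<close>, since \<open>p - 1\<close> is positive.\<close>
    then obtain k where k: "g ^ ((p - 1) * M) - 1 = int p * k"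
      by (rule dvdE)
    obtain w where w: "set w \<subseteq> power_generators g" "sum_list w = k"
      "length w = word_length (power_generators g) k" by (rule word_length_witness)
    have "length w \<le> L"
      using L[of k] word_length_power_minus_one_le[of g "(p - 1) * M"] k w by simp
    moreover have "M \<le> (p - 1) * M"
      using prime_gt_1_nat[OF p] by (cases p) auto
    then have "g ^ M dvd g ^ ((p - 1) * M)"
      by (rule le_imp_power_dvd)
    then have "g ^ M dvd int p * sum_list w + 1"
      using w(2) k by (metis diff_add_cancel)
    ultimately show False
      using M w by blast
  qed
  moreover have "coarse_equivalence (power_dist g) (power_dist g) (\<lambda>k. int p * k)"
    if p: "prime p" and dvd: "int p dvd g" for p
  proof -
    obtain c where c: "g = int p * c"
      using dvd by (rule dvdE)
    \<comment> \<open>Positivity lets the cofactor serve as the natural number \<open>q\<close> of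
      \<open>coarse_equivalence_mult_dvd\<close>.\<close>
    have "c > 0"
      using c assms zero_less_mult_pos[of "int p" c] prime_gt_0_nat[OF p] by simp
    then show ?thesis
      using coarse_equivalence_mult_dvd[of p "nat c"] prime_gt_0_nat[OF p] c by simp
  qed
  ultimately show ?thesis
    unfolding prime_power_spectrum_def by auto
qed

end
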